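(* Let $A$ be a separable $C^*$-algebra and $B\subseteq A$ a Cartan subalgebra. Suppose there exists a subset $N$ of $N(B)$ which densely spans $A$ (i.e. the linear span of $N$ is norm-dense in $A$). Then every element of the Weyl groupoid associated to $(A,B)$ can be represented by some triple $(\alpha_m(x),m,x)$ where $m\in N$ (and $x\in\mathrm{dom}(m)$).
   Context: A $C^*$-subalgebra $B\subseteq A$ is Cartan if it is maximal abelian, there is a faithful conditional expectation $A\to B$, the normalizer $N(B)=\{n\in A:nbn^*,n^*bn\in B\ \forall b\in B\}$ generates $A$ as a $C^*$-algebra, and $B$ contains an approximate identity for $A$. Identify $B\cong C_0(\widehat B)$ by Gelfand duality. For $n\in N(B)$ let $\mathrm{dom}(n)=\{x\in\widehat B:n^*n(x)>0\}$. There is a unique homeomorphism $\alpha_n:\mathrm{dom}(n)\to\mathrm{dom}(n^* )$ satisfying $n^*bn=(b\circ\alpha_n)\cdot n^*n$ for all $b\in B$ (where the right-hand side is read as $0$ off $\mathrm{dom}(n)$). As a set, the Weyl groupoid $\mathcal{G}_{(A,B)}$ is the quotient of $\{(\alpha_n(x),n,x):n\in N(B),\ x\in\mathrm{dom}(n)\}$ by the equivalence relation $(\alpha_n(x),n,x)\sim(\alpha_m(y),m,y)$ iff $x=y$ and there is an open $U\subseteq\widehat B$ with $x\in U$ and $\alpha_n|_U=\alpha_m|_U$. *)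

theory Defs
  imports "HOL-Analysis.Analysis"
begin

section \<open>C*-algebras\<close>

text \<open>A C*-algebra is a type of this class. It need not be unital, and the zero algebra is allowed.\<close>

class cstar_algebra = real_normed_algebra + banach +
  fixes scaleC :: "complex \<Rightarrow> 'a \<Rightarrow> 'a" (infixr \<open>*\<^sub>C\<close> 75)
    and adj :: "'a \<Rightarrow> 'a"
  assumes scaleC_add_right: "c *\<^sub>C (x + y) = c *\<^sub>C x + c *\<^sub>C y"
    and scaleC_add_left: "(c + d) *\<^sub>C x = c *\<^sub>C x + d *\<^sub>C x"
    and scaleC_scaleC: "c *\<^sub>C d *\<^sub>C x = (c * d) *\<^sub>C x"
    and scaleC_of_real: "complex_of_real r *\<^sub>C x = r *\<^sub>R x"
    and norm_scaleC: "norm (c *\<^sub>C x) = cmod c * norm x"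
    and mult_scaleC_left: "(c *\<^sub>C x) * y = c *\<^sub>C (x * y)"
    and mult_scaleC_right: "x * (c *\<^sub>C y) = c *\<^sub>C (x * y)"
    and adj_adj: "adj (adj x) = x"
    and adj_add: "adj (x + y) = adj x + adj y"
    and adj_scaleC: "adj (c *\<^sub>C x) = cnj c *\<^sub>C adj x"
    and adj_mult: "adj (x * y) = adj y * adj x"
    and cstar_identity: "norm (adj x * x) = (norm x)\<^sup>2"

global_interpretation complex_vector: vector_space "scaleC :: complex \<Rightarrow> 'a \<Rightarrow> 'a::cstar_algebra"
  defines csubspace = complex_vector.subspace
    and cspan = complex_vector.span
proof
  show "1 *\<^sub>C x = x" for x :: 'a
    using scaleC_of_real[of 1 x] by simp
qed (simp_all add: scaleC_add_right scaleC_add_left scaleC_scaleC)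

definition cstar_subalgebra :: "'a::cstar_algebra set \<Rightarrow> bool" where
  "cstar_subalgebra B \<longleftrightarrow> csubspace B \<and> closed B \<and>
     (\<forall>a\<in>B. \<forall>b\<in>B. a * b \<in> B) \<and> (\<forall>a\<in>B. adj a \<in> B)"

definition positive_in :: "'a::cstar_algebra set \<Rightarrow> 'a \<Rightarrow> bool" where
  "positive_in B a \<longleftrightarrow> (\<exists>c\<in>B. a = adj c * c)"

definition conditional_expectation :: "'a::cstar_algebra set \<Rightarrow> ('a \<Rightarrow> 'a) \<Rightarrow> bool" where
  "conditional_expectation B E \<longleftrightarrow>
     Vector_Spaces.linear scaleC scaleC E \<and>
     range E \<subseteq> B \<and> (\<forall>b\<in>B. E b = b) \<and>
     (\<forall>a. norm (E a) \<le> norm a) \<and>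
     (\<forall>a. positive_in UNIV a \<longrightarrow> positive_in B (E a)) \<and>
     (\<forall>b\<in>B. \<forall>c\<in>B. \<forall>a. E (b * a * c) = b * E a * c)"

definition faithful_map :: "('a::cstar_algebra \<Rightarrow> 'a) \<Rightarrow> bool" where
  "faithful_map E \<longleftrightarrow> (\<forall>a. E (adj a * a) = 0 \<longrightarrow> a = 0)"

text \<open>Nets are rendered by filters: a net gives the filter generated by its tails, and
  a proper filter gives a net indexed by the pairs of a member set and a point in it.\<close>

definition contains_approximate_identity :: "'a::cstar_algebra set \<Rightarrow> bool" where
  "contains_approximate_identity B \<longleftrightarrow>
     (\<exists>F. F \<noteq> bot \<and> eventually (\<lambda>u. u \<in> B \<and> positive_in B u \<and> norm u \<le> 1) F \<and>
       (\<forall>a. ((\<lambda>u. u * a) \<longlongrightarrow> a) F \<and> ((\<lambda>u. a * u) \<longlongrightarrow> a) F))"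

section \<open>Cartan subalgebras\<close>

definition abelian :: "'a::cstar_algebra set \<Rightarrow> bool" where
  "abelian B \<longleftrightarrow> (\<forall>a\<in>B. \<forall>b\<in>B. a * b = b * a)"

definition maximal_abelian :: "'a::cstar_algebra set \<Rightarrow> bool" where
  "maximal_abelian B \<longleftrightarrow> cstar_subalgebra B \<and> abelian B \<and>
     (\<forall>C. cstar_subalgebra C \<and> abelian C \<and> B \<subseteq> C \<longrightarrow> C = B)"

definition normalizer :: "'a::cstar_algebra set \<Rightarrow> 'a set" where
  "normalizer B = {n. \<forall>b\<in>B. n * b * adj n \<in> B \<and> adj n * b * n \<in> B}"

definition cartan_subalgebra :: "'a::cstar_algebra set \<Rightarrow> bool" where
  "cartan_subalgebra B \<longleftrightarrow> cstar_subalgebra B \<and> maximal_abelian B \<and>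
     (\<exists>E. conditional_expectation B E \<and> faithful_map E) \<and>
     cstar_subalgebra hull normalizer B = UNIV \<and>
     contains_approximate_identity B"

section \<open>The Gelfand spectrum\<close>

text \<open>Characters are functions on \<open>B\<close>; being elements of a total function type, they are
  normalized to be \<open>undefined\<close> off \<open>B\<close>, so that equality means equality on \<open>B\<close>.
  The Gelfand transform of \<open>b\<close> sends \<open>x\<close> to \<open>x b\<close>.\<close>

definition gelfand_spectrum :: "'a::cstar_algebra set \<Rightarrow> ('a \<Rightarrow> complex) set" where
  "gelfand_spectrum B = {x \<in> extensional B.
     (\<forall>a\<in>B. \<forall>b\<in>B. x (a + b) = x a + x b) \<and>
     (\<forall>c. \<forall>b\<in>B. x (c *\<^sub>C b) = c * x b) \<and>
     (\<forall>a\<in>B. \<forall>b\<in>B. x (a * b) = x a * x b) \<and>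
     (\<exists>b\<in>B. x b \<noteq> 0)}"

text \<open>The weak-* topology, i.e. that of pointwise convergence on \<open>B\<close>.\<close>

definition gelfand_topology :: "'a::cstar_algebra set \<Rightarrow> ('a \<Rightarrow> complex) topology" where
  "gelfand_topology B =
     subtopology (product_topology (\<lambda>_. euclidean) B) (gelfand_spectrum B)"

section \<open>The Weyl groupoid\<close>

text \<open>The order is the one on \<^typ>\<open>complex\<close>: \<open>0 < z\<close> says that \<open>z\<close> is real and positive.\<close>

definition weyl_dom :: "'a::cstar_algebra set \<Rightarrow> 'a \<Rightarrow> ('a \<Rightarrow> complex) set" where
  "weyl_dom B n = {x \<in> gelfand_spectrum B. 0 < x (adj n * n)}"

text \<open>\<open>\<alpha>\<^sub>n\<close>, as a function that is \<open>undefined\<close> off \<open>dom n\<close>. The last clause is the identity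
  \<open>n\<^sup>* b n = (b \<circ> \<alpha>\<^sub>n) \<cdot> n\<^sup>* n\<close> in \<open>C\<^sub>0\<close> of the spectrum, evaluated at all points \<open>x\<close>.\<close>

definition weyl_map ::
  "'a::cstar_algebra set \<Rightarrow> 'a \<Rightarrow> ('a \<Rightarrow> complex) \<Rightarrow> ('a \<Rightarrow> complex)" where
  "weyl_map B n = (THE \<alpha>. \<alpha> \<in> extensional (weyl_dom B n) \<and>
     homeomorphic_map (subtopology (gelfand_topology B) (weyl_dom B n))
       (subtopology (gelfand_topology B) (weyl_dom B (adj n))) \<alpha> \<and>
     (\<forall>b\<in>B. \<forall>x\<in>gelfand_spectrum B.
        x (adj n * b * n) = (if x \<in> weyl_dom B n then \<alpha> x b * x (adj n * n) else 0)))"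

type_synonym 'a weyl_triple = "('a \<Rightarrow> complex) \<times> 'a \<times> ('a \<Rightarrow> complex)"

definition weyl_triples :: "'a::cstar_algebra set \<Rightarrow> 'a weyl_triple set" where
  "weyl_triples B = {(weyl_map B n x, n, x) | n x. n \<in> normalizer B \<and> x \<in> weyl_dom B n}"

text \<open>The restrictions of \<open>\<alpha>\<^sub>n\<close> and \<open>\<alpha>\<^sub>m\<close> to \<open>U\<close> only make sense for \<open>U\<close> inside both domains. As
  the domains are open, this agrees with comparing restrictions of partial maps.\<close>

definition weyl_rel :: "'a::cstar_algebra set \<Rightarrow> ('a weyl_triple \<times> 'a weyl_triple) set" where
  "weyl_rel B = {((y, n, x), (y', m, x')).
     (y, n, x) \<in> weyl_triples B \<and> (y', m, x') \<in> weyl_triples B \<and> x = x' \<and>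
     (\<exists>U. openin (gelfand_topology B) U \<and> x \<in> U \<and> U \<subseteq> weyl_dom B n \<inter> weyl_dom B m \<and>
        (\<forall>z\<in>U. weyl_map B n z = weyl_map B m z))}"

definition weyl_groupoid :: "'a::cstar_algebra set \<Rightarrow> 'a weyl_triple set set" where
  "weyl_groupoid B = weyl_triples B // weyl_rel B"

end

theory Submission
  imports Defs
begin

text \<open>Write \<open>E\<close> for the conditional expectation and \<open>k = n\<^sup>* m\<close> for normalizers \<open>n\<close>, \<open>m\<close>. Since
  \<open>k k\<^sup>*\<close> commutes with \<open>B\<close>, one has \<open>k (k\<^sup>* b k) = b k (k\<^sup>* k)\<close>; applying \<open>E\<close> and evaluating at a
  point \<open>z\<close> with \<open>E k\<close> nonzero at \<open>z\<close> shows that \<open>\<alpha>\<^sub>k\<close> fixes \<open>z\<close>, i.e. \<open>\<alpha>\<^sub>n\<close> and \<open>\<alpha>\<^sub>m\<close> agree on the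
  open set where \<open>E (n\<^sup>* m)\<close> does not vanish. Some \<open>m \<in> N\<close> has \<open>x\<close> in this set: otherwise, by
  linearity and density, \<open>E (n\<^sup>* n) = n\<^sup>* n\<close> would vanish at \<open>x \<in> dom n\<close>.\<close>

section \<open>Algebraic preliminaries\<close>

lemma adj_minus: "adj (- x) = - adj (x :: 'a::cstar_algebra)"
  using adj_scaleC[of "-1" x] by (simp add: complex_vector.scale_minus_left)

lemma adj_diff: "adj (x - y) = adj x - adj (y :: 'a::cstar_algebra)"
  using adj_add[of x "- y"] by (simp add: adj_minus)

text \<open>The Cartan condition only asserts that an expectation exists; here one is fixed as a
  parameter so that the lemmas can name it. The approximate identity serves as a substitute for a
  unit.\<close>

locale expected_subalgebra =
  fixes B :: "'a::cstar_algebra set" and E :: "'a \<Rightarrow> 'a"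
  assumes subalgebra: "cstar_subalgebra B"
    and abelian: "abelian B"
    and expectation: "conditional_expectation B E"
    and approximate_identity: "contains_approximate_identity B"
begin

lemma csubspace: "csubspace B" and closed: "closed B"
  and mult_in: "a \<in> B \<Longrightarrow> b \<in> B \<Longrightarrow> a * b \<in> B"
  and adj_in: "a \<in> B \<Longrightarrow> adj a \<in> B"
  using subalgebra by (auto simp: cstar_subalgebra_def)

lemma add_in: "a \<in> B \<Longrightarrow> b \<in> B \<Longrightarrow> a + b \<in> B"
  and diff_in: "a \<in> B \<Longrightarrow> b \<in> B \<Longrightarrow> a - b \<in> B"
  and scale_in: "b \<in> B \<Longrightarrow> c *\<^sub>C b \<in> B"
  and zero_in: "0 \<in> B"
  using csubspace by (auto intro: complex_vector.subspace_add complex_vector.subspace_diff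
      complex_vector.subspace_scale complex_vector.subspace_0)

lemma commute: "a \<in> B \<Longrightarrow> b \<in> B \<Longrightarrow> a * b = b * a"
  using abelian by (auto simp: abelian_def)

lemma approximate_identityE:
  obtains F where "F \<noteq> bot" "\<forall>\<^sub>F u in F. u \<in> B" "\<forall>\<^sub>F u in F. norm u \<le> 1"
    "\<And>a. ((\<lambda>u. u * a) \<longlongrightarrow> a) F" "\<And>a. ((\<lambda>u. a * u) \<longlongrightarrow> a) F"
  using approximate_identity
  by (auto simp: contains_approximate_identity_def eventually_conj_iff)

subsection \<open>Characters\<close>

context
  fixes x assumes x: "x \<in> gelfand_spectrum B"
begin

lemma char_add: "a \<in> B \<Longrightarrow> b \<in> B \<Longrightarrow> x (a + b) = x a + x b"
  and char_scale: "b \<in> B \<Longrightarrow> x (c *\<^sub>C b) = c * x b"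
  and char_mult: "a \<in> B \<Longrightarrow> b \<in> B \<Longrightarrow> x (a * b) = x a * x b"
  and char_extensional: "x \<in> extensional B"
  using x by (auto simp: gelfand_spectrum_def)

lemma char_nonzeroE:
  obtains b where "b \<in> B" "x b \<noteq> 0"
  using x by (auto simp: gelfand_spectrum_def)

lemma char_zero: "x 0 = 0"
  using char_scale[of 0 0] zero_in by simp

lemma char_diff: "a \<in> B \<Longrightarrow> b \<in> B \<Longrightarrow> x (a - b) = x a - x b"
  using char_add[of "a - b" b] diff_in by simp

text \<open>A larger value would rescale to \<open>d\<close> with \<open>x d = 1\<close> and norm
  below 1. Then 1 - d is invertible in the unitization, although the extension of \<open>x\<close>
  kills it.\<close>

lemma char_norm_le:
  assumes "b \<in> B"
  shows "cmod (x b) \<le> norm b"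
proof (rule ccontr)
  assume less: "\<not> ?thesis"
  then have nz: "x b \<noteq> 0" by auto
  define d where "d = (1 / x b) *\<^sub>C b"
  have d: "d \<in> B" "x d = 1"
    using assms nz by (simp_all add: d_def scale_in char_scale)
  have nd: "norm d < 1"
    using less nz by (simp add: d_def norm_scaleC norm_divide divide_simps)
  \<comment> \<open>Non-unital Neumann series: \<open>c = d + d\<^sup>2 + \<dots>\<close>.\<close>
  have "\<exists>!c\<in>B. d + d * c = c"
  proof (rule Banach_fix)
    show "complete B" using closed by (simp add: complete_eq_closed)
    show "B \<noteq> {}" using zero_in by auto
    show "(\<lambda>c. d + d * c) ` B \<subseteq> B" using d by (auto intro: add_in mult_in)
    show "dist (d + d * a) (d + d * c) \<le> norm d * dist a c" for a c
      using norm_mult_ineq[of d "a - c"] by (simp add: dist_norm algebra_simps)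
  qed (use nd in auto)
  then obtain c where c: "c \<in> B" "d + d * c = c" by blast
  \<comment> \<open>Since \<open>x d = 1\<close>, the fixed-point equation reads
    \<open>x c = 1 + x c\<close>.\<close>
  have "x c = x d + x d * x c"
    using c d char_add[of d "d * c"] by (simp add: char_mult mult_in)
  with d show False by simp
qed

lemma char_tendsto:
  assumes "(f \<longlongrightarrow> a) F" "\<forall>\<^sub>F u in F. f u \<in> B" "a \<in> B"
  shows "((\<lambda>u. x (f u)) \<longlongrightarrow> x a) F"
proof (rule LIM_zero_cancel, rule Lim_null_comparison)
  show "\<forall>\<^sub>F u in F. norm (x (f u) - x a) \<le> norm (f u - a)"
    using assms(2) by eventually_elim (metis assms(3) char_diff char_norm_le diff_in)
  show "((\<lambda>u. norm (f u - a)) \<longlongrightarrow> 0) F"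
    using assms(1) by (intro tendsto_norm_zero LIM_zero)
qed

text \<open>Arens' argument: the C*-identity bounds the squared modulus of x h + i t by a constant
  plus t^2, while its expansion contains the linear term 2 t Im(x h), whose coefficient must
  therefore vanish.\<close>

lemma char_self_adjoint:
  assumes h: "h \<in> B" "adj h = h"
  shows "Im (x h) = 0"
proof -
  obtain F where F: "F \<noteq> bot" "\<forall>\<^sub>F u in F. u \<in> B" "\<forall>\<^sub>F u in F. norm u \<le> 1"
    "\<And>a. ((\<lambda>u. u * a) \<longlongrightarrow> a) F"
    by (rule approximate_identityE) (rule that)
  obtain b where b: "b \<in> B" "x b \<noteq> 0" by (rule char_nonzeroE)
  have "((\<lambda>u. x (u * b)) \<longlongrightarrow> x b) F"
    using F(2) by (intro char_tendsto F b) (auto elim!: eventually_mono intro: mult_in b)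
  moreover have "\<forall>\<^sub>F u in F. x (u * b) = x u * x b"
    using F(2) by eventually_elim (simp add: b char_mult)
  ultimately have "((\<lambda>u. x u * x b) \<longlongrightarrow> x b) F"
    by (rule Lim_transform_eventually)
  \<comment> \<open>Dividing by the nonzero \<open>x b\<close> shows that \<open>x\<close> takes the
    approximate identity to 1.\<close>
  from tendsto_divide[OF this tendsto_const[of "x b"]] b(2) have lim: "(x \<longlongrightarrow> 1) F"
    by simp
  \<comment> \<open>The approximate identity stands in for the missing unit: compare \<open>(h + i t) u\<close> as \<open>u\<close> varies.\<close>
  have bound: "(cmod (x h + \<i> * of_real t))\<^sup>2 \<le> (norm h)\<^sup>2 + t\<^sup>2" for t :: real
  proof (rule tendsto_upperbound)
    show "((\<lambda>u. (cmod ((x h + \<i> * of_real t) * x u))\<^sup>2) \<longlongrightarrow> (cmod (x h + \<i> * of_real t))\<^sup>2) F"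
      by (rule tendsto_eq_intros lim refl)+ simp
    show "\<forall>\<^sub>F u in F. (cmod ((x h + \<i> * of_real t) * x u))\<^sup>2 \<le> (norm h)\<^sup>2 + t\<^sup>2"
      using F(2,3)
    proof eventually_elim
      case (elim u)
      have nhu: "norm (h * u) \<le> norm h"
        using norm_mult_ineq[of h u] elim mult_left_le[of "norm u" "norm h"] by fastforce
      define c :: complex where "c = \<i> * of_real t"
      define v where "v = h * u + c *\<^sub>C u"
      have v: "v \<in> B" using elim h by (simp add: v_def add_in mult_in scale_in)
      have "x v = (x h + c) * x u"
        using elim h by (simp add: v_def char_add char_scale char_mult mult_in scale_in distrib_right)
      then have "(cmod ((x h + c) * x u))\<^sup>2 \<le> (norm v)\<^sup>2"
        using char_norm_le[OF v] by (simp add: power_mono)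
      also have "(norm v)\<^sup>2 = norm (adj v * v)" by (simp add: cstar_identity)
      also have "adj v * v = adj (h * u) * (h * u) + (cnj c * c) *\<^sub>C (adj u * u)
          + (c *\<^sub>C (adj u * h * u) + cnj c *\<^sub>C (adj u * h * u))"
        by (simp add: v_def adj_add adj_scaleC adj_mult h mult_scaleC_left mult_scaleC_right
            scaleC_scaleC scaleC_add_right distrib_left distrib_right mult.assoc add_ac mult.commute)
      \<comment> \<open>The cross terms cancel because \<open>c\<close> is purely imaginary.\<close>
      also have "c *\<^sub>C (adj u * h * u) + cnj c *\<^sub>C (adj u * h * u) = 0"
        by (simp flip: scaleC_add_left add: c_def)
      also have "norm (adj (h * u) * (h * u) + (cnj c * c) *\<^sub>C (adj u * u) + 0)
          \<le> norm (adj (h * u) * (h * u)) + norm ((cnj c * c) *\<^sub>C (adj u * u))"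
        using norm_triangle_ineq by simp
      also have "\<dots> = (norm (h * u))\<^sup>2 + t\<^sup>2 * (norm u)\<^sup>2"
        unfolding norm_scaleC cstar_identity by (simp add: c_def norm_mult power2_eq_square)
      also have "(norm (h * u))\<^sup>2 + t\<^sup>2 * (norm u)\<^sup>2 \<le> (norm h)\<^sup>2 + t\<^sup>2"
        using elim nhu by (intro add_mono power_mono) (auto intro: mult_left_le simp: power_le_one)
      finally show ?case by (simp add: c_def)
    qed
  qed (use F in auto)
  show ?thesis
  proof (rule ccontr)
    assume nz: "Im (x h) \<noteq> 0"
    \<comment> \<open>Chosen so that the linear term equals \<open>(norm h)\<^sup>2 + 1\<close>, one
      more than \<open>bound\<close> leaves room for.\<close>
    define t where "t = ((norm h)\<^sup>2 + 1) / (2 * Im (x h))"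
    have "(Re (x h))\<^sup>2 + (Im (x h))\<^sup>2 + 2 * Im (x h) * t \<le> (norm h)\<^sup>2"
      using bound[of t] by (simp add: cmod_power2 power2_sum)
    moreover have "2 * Im (x h) * t = (norm h)\<^sup>2 + 1"
      using nz by (simp add: t_def)
    ultimately show False
      using zero_le_power2[of "Re (x h)"] zero_le_power2[of "Im (x h)"] by linarith
  qed
qed

text \<open>Compatibility with the adjoint is derived rather than built into
  \<open>gelfand_spectrum\<close>: both \<open>b + adj b\<close> and i (b - adj b) are self-adjoint,
  so their values are real.\<close>

lemma char_adj:
  assumes "b \<in> B"
  shows "x (adj b) = cnj (x b)"
proof -
  have "Im (x (b + adj b)) = 0"
    using assms by (intro char_self_adjoint) (auto simp: adj_add adj_adj add_in adj_in)
  moreover have "Im (x (\<i> *\<^sub>C (b - adj b))) = 0"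
    using assms
    by (intro char_self_adjoint)
      (auto simp: adj_diff adj_adj adj_scaleC diff_in adj_in scale_in
        complex_vector.scale_right_diff_distrib)
  ultimately show ?thesis
    using assms by (simp add: complex_eq_iff char_add char_diff char_scale diff_in adj_in)
qed

lemma char_adj_mult_nonneg: "b \<in> B \<Longrightarrow> 0 \<le> x (adj b * b)"
  by (simp add: char_mult char_adj adj_in less_eq_complex_def)

end

subsection \<open>Normalizers and the conditional expectation\<close>

lemma expectation_in: "E a \<in> B"
  and expectation_id: "b \<in> B \<Longrightarrow> E b = b"
  and expectation_norm_le: "norm (E a) \<le> norm a"
  and expectation_bimodule: "b \<in> B \<Longrightarrow> c \<in> B \<Longrightarrow> E (b * a * c) = b * E a * c"
  using expectation by (auto simp: conditional_expectation_def)

lemma expectation_linear: "Vector_Spaces.linear scaleC scaleC E"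
  using expectation by (auto simp: conditional_expectation_def)

lemma expectation_add: "E (a + b) = E a + E b"
  and expectation_scale: "E (c *\<^sub>C a) = c *\<^sub>C E a"
  using expectation_linear
  by (simp_all add: Vector_Spaces.linear_iff)

lemma expectation_diff: "E (a - b) = E a - E b"
  using expectation_add[of "a - b" b] by simp

lemma expectation_tendsto: "(f \<longlongrightarrow> a) F \<Longrightarrow> ((\<lambda>u. E (f u)) \<longlongrightarrow> E a) F"
  by (rule LIM_zero_cancel, rule Lim_null_comparison[where g = "\<lambda>u. norm (f u - a)"])
    (auto intro: tendsto_norm_zero LIM_zero simp: expectation_norm_le simp flip: expectation_diff)

lemma expectation_adj_mult: "\<exists>c\<in>B. E (adj a * a) = adj c * c"
  using expectation by (auto simp: conditional_expectation_def positive_in_def)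

text \<open>The bimodule law in the definition has a factor from \<open>B\<close> on each side.
  Letting the unwanted one run through the approximate identity removes it in the limit, by
  continuity of \<open>E\<close>.\<close>

lemma expectation_left: "b \<in> B \<Longrightarrow> E (b * a) = b * E a"
  and expectation_right: "b \<in> B \<Longrightarrow> E (a * b) = E a * b"
proof -
  assume b: "b \<in> B"
  obtain F where F: "F \<noteq> bot" "\<forall>\<^sub>F u in F. u \<in> B"
    "\<And>a. ((\<lambda>u. u * a) \<longlongrightarrow> a) F" "\<And>a. ((\<lambda>u. a * u) \<longlongrightarrow> a) F"
    by (rule approximate_identityE) (rule that)
  have "((\<lambda>u. E (b * a * u)) \<longlongrightarrow> E (b * a)) F"
    by (intro expectation_tendsto F)
  moreover have "\<forall>\<^sub>F u in F. E (b * a * u) = b * E a * u"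
    using F(2) by eventually_elim (simp add: b expectation_bimodule)
  ultimately have "((\<lambda>u. b * E a * u) \<longlongrightarrow> E (b * a)) F"
    by (rule Lim_transform_eventually)
  with F show "E (b * a) = b * E a" using tendsto_unique by blast
  have "((\<lambda>u. E (u * (a * b))) \<longlongrightarrow> E (a * b)) F"
    by (intro expectation_tendsto F)
  moreover have "\<forall>\<^sub>F u in F. E (u * (a * b)) = u * (E a * b)"
    using F(2) by eventually_elim (simp add: b flip: mult.assoc expectation_bimodule)
  ultimately have "((\<lambda>u. u * (E a * b)) \<longlongrightarrow> E (a * b)) F"
    by (rule Lim_transform_eventually)
  with F show "E (a * b) = E a * b" using tendsto_unique by blast
qed

lemma normalizer_adj: "n \<in> normalizer B \<Longrightarrow> adj n \<in> normalizer B"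
  by (simp add: normalizer_def adj_adj)

lemma normalizer_conj: "n \<in> normalizer B \<Longrightarrow> b \<in> B \<Longrightarrow> adj n * b * n \<in> B"
  and normalizer_conj': "n \<in> normalizer B \<Longrightarrow> b \<in> B \<Longrightarrow> n * b * adj n \<in> B"
  by (simp_all add: normalizer_def)

lemma normalizer_mult:
  assumes "n \<in> normalizer B" "m \<in> normalizer B"
  shows "n * m \<in> normalizer B"
proof -
  have "n * (m * b * adj m) * adj n \<in> B" "adj m * (adj n * b * n) * m \<in> B" if "b \<in> B" for b
    using that assms by (simp_all add: normalizer_conj normalizer_conj')
  then show ?thesis by (simp add: normalizer_def adj_mult mult.assoc)
qed

text \<open>\<open>adj n * u * n\<close> lies in \<open>B\<close> for \<open>u\<close> from the
  approximate identity, and \<open>B\<close> is closed.\<close>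

lemma normalizer_adj_mult:
  assumes n: "n \<in> normalizer B"
  shows "adj n * n \<in> B"
proof -
  obtain F where F: "F \<noteq> bot" "\<forall>\<^sub>F u in F. u \<in> B" "\<And>a. ((\<lambda>u. u * a) \<longlongrightarrow> a) F"
    by (rule approximate_identityE) (rule that)
  show ?thesis
  proof (rule Lim_in_closed_set[OF closed _ F(1)])
    show "\<forall>\<^sub>F u in F. adj n * (u * n) \<in> B"
      using F(2) by eventually_elim (simp add: n normalizer_conj flip: mult.assoc)
    show "((\<lambda>u. adj n * (u * n)) \<longlongrightarrow> adj n * n) F"
      by (intro tendsto_intros F)
  qed
qed

lemma normalizer_mult_adj: "n \<in> normalizer B \<Longrightarrow> n * adj n \<in> B"
  using normalizer_adj_mult[OF normalizer_adj] by (simp add: adj_adj)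

text \<open>As \<open>n\<close> may lie outside \<open>B\<close>, nonnegativity of
  \<open>x (adj n * n)\<close> is not immediate. But \<open>E\<close> fixes
  \<open>adj n * n\<close>, and positivity of \<open>E\<close> rewrites it as
  \<open>adj c * c\<close> with \<open>c\<close> in \<open>B\<close>.\<close>

lemma weyl_dom_iff:
  assumes n: "n \<in> normalizer B"
  shows "x \<in> weyl_dom B n \<longleftrightarrow> x \<in> gelfand_spectrum B \<and> x (adj n * n) \<noteq> 0"
proof -
  obtain c where c: "c \<in> B" "E (adj n * n) = adj c * c"
    using expectation_adj_mult by blast
  then have "adj n * n = adj c * c"
    using n by (simp add: expectation_id normalizer_adj_mult)
  then show ?thesis
    using char_adj_mult_nonneg[OF _ c(1), of x] by (auto simp: weyl_dom_def less_le)
qed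

text \<open>\<open>n * adj n\<close> belongs to \<open>B\<close> and so commutes with
  \<open>c\<close>. This is multiplicativity of the future \<open>\<alpha>\<^sub>n\<close> with
  denominators cleared, valid also at points outside \<open>weyl_dom B n\<close>.\<close>

lemma char_normalizer_mult:
  assumes n: "n \<in> normalizer B" and x: "x \<in> gelfand_spectrum B" and b: "b \<in> B" and c: "c \<in> B"
  shows "x (adj n * b * n) * x (adj n * c * n) = x (adj n * (b * c) * n) * x (adj n * n)"
proof -
  have "(adj n * b * n) * (adj n * c * n) = adj n * b * ((n * adj n) * c) * n"
    by (simp add: mult.assoc)
  also have "(n * adj n) * c = c * (n * adj n)"
    by (simp add: commute normalizer_mult_adj n c)
  also have "adj n * b * (c * (n * adj n)) * n = (adj n * (b * c) * n) * (adj n * n)"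
    by (simp add: mult.assoc)
  finally show ?thesis
    using assms by (simp add: normalizer_conj normalizer_adj_mult mult_in flip: char_mult[OF x])
qed

lemma char_normalizer_zero:
  assumes "n \<in> normalizer B" "x \<in> gelfand_spectrum B" "b \<in> B" "x (adj n * n) = 0"
  shows "x (adj n * b * n) = 0"
  \<comment> \<open>With equal middle factors, the square of the value is a multiple of
    \<open>x (adj n * n)\<close>.\<close>
  using char_normalizer_mult[of n x b b] assms by simp

subsection \<open>The partial homeomorphisms\<close>

text \<open>The value that the identity in \<open>weyl_map\<close> forces on
  \<open>\<alpha>\<^sub>n\<close> at points of the domain. Restriction to \<open>B\<close> matches
  the normal form of characters.\<close>

definition weyl_char :: "'a \<Rightarrow> ('a \<Rightarrow> complex) \<Rightarrow> 'a \<Rightarrow> complex" where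
  "weyl_char n x = (\<lambda>b\<in>B. x (adj n * b * n) / x (adj n * n))"

lemma weyl_char_in_dom:
  assumes n: "n \<in> normalizer B" and x: "x \<in> weyl_dom B n"
  shows "weyl_char n x \<in> weyl_dom B (adj n)"
proof -
  have xs: "x \<in> gelfand_spectrum B" and nz: "x (adj n * n) \<noteq> 0"
    using x by (simp_all add: weyl_dom_iff n)
  \<comment> \<open>The value at \<open>n * adj n\<close> serves twice: it shows that the new
    character is nonzero and that it lies in the domain of \<open>adj n\<close>.\<close>
  have "x (adj n * (n * adj n) * n) = x ((adj n * n) * (adj n * n))"
    by (simp add: mult.assoc)
  also have "\<dots> = x (adj n * n) * x (adj n * n)"
    by (simp add: char_mult[OF xs] normalizer_adj_mult n)
  finally have nn: "weyl_char n x (n * adj n) = x (adj n * n)"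
    using n nz by (simp add: weyl_char_def normalizer_mult_adj)
  have "weyl_char n x \<in> gelfand_spectrum B"
    unfolding gelfand_spectrum_def
  proof (intro CollectI conjI ballI allI)
    show "\<exists>b\<in>B. weyl_char n x b \<noteq> 0"
      using nn nz normalizer_mult_adj[OF n] by (intro bexI[of _ "n * adj n"]) simp_all
  next
    fix a b assume "a \<in> B" "b \<in> B"
    then show "weyl_char n x (a + b) = weyl_char n x a + weyl_char n x b"
      by (simp add: weyl_char_def add_in distrib_left distrib_right char_add[OF xs]
          normalizer_conj n add_divide_distrib)
  next
    fix a b assume "a \<in> B" "b \<in> B"
    then show "weyl_char n x (a * b) = weyl_char n x a * weyl_char n x b"
      using char_normalizer_mult[OF n xs, of a b] nz
      by (simp add: weyl_char_def mult_in field_simps)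
  qed (simp_all add: weyl_char_def scale_in mult_scaleC_right mult_scaleC_left
      char_scale[OF xs] normalizer_conj n)
  with nn nz show ?thesis by (simp add: weyl_dom_iff normalizer_adj n adj_adj)
qed

text \<open>Conjugating by \<open>n\<close> and back multiplies \<open>b\<close> on both sides by
  \<open>adj n * n\<close>; the resulting scalar factors cancel in the quotient.\<close>

lemma weyl_char_inverse:
  assumes n: "n \<in> normalizer B" and x: "x \<in> weyl_dom B n"
  shows "weyl_char (adj n) (weyl_char n x) = x"
proof (rule extensionalityI[of _ B])
  have xs: "x \<in> gelfand_spectrum B" and nz: "x (adj n * n) \<noteq> 0"
    using x by (simp_all add: weyl_dom_iff n)
  show "x \<in> extensional B" by (rule char_extensional[OF xs])
  fix b assume b: "b \<in> B"
  have "adj n * (n * b * adj n) * n = (adj n * n) * b * (adj n * n)"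
    "adj n * (n * adj n) * n = (adj n * n) * (adj n * n)"
    by (simp_all add: mult.assoc)
  then show "weyl_char (adj n) (weyl_char n x) b = x b"
    using b n nz
    by (simp add: weyl_char_def adj_adj normalizer_conj' normalizer_mult_adj
        char_mult[OF xs] normalizer_adj_mult mult_in)
qed (simp add: weyl_char_def)

section \<open>Topology of the spectrum and continuity of the partial maps\<close>

lemma topspace_gelfand: "topspace (gelfand_topology B) = gelfand_spectrum B"
  by (auto simp: gelfand_topology_def gelfand_spectrum_def PiE_def)

lemma continuous_map_eval:
  "b \<in> B \<Longrightarrow> continuous_map (gelfand_topology B) euclidean (\<lambda>x. x b)"
  unfolding gelfand_topology_def
  by (intro continuous_map_from_subtopology continuous_map_product_projection)

lemma openin_nonvanishing:
  assumes "b \<in> B"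
  shows "openin (gelfand_topology B) {x \<in> gelfand_spectrum B. x b \<noteq> 0}"
  using openin_continuous_map_preimage[OF continuous_map_eval[OF assms], of "- {0}"]
  by (simp add: topspace_gelfand open_Compl)

lemma openin_weyl_dom:
  assumes "n \<in> normalizer B"
  shows "openin (gelfand_topology B) (weyl_dom B n)"
proof -
  have "weyl_dom B n = {x \<in> gelfand_spectrum B. x (adj n * n) \<noteq> 0}"
    using weyl_dom_iff[OF assms] by auto
  with openin_nonvanishing[OF normalizer_adj_mult[OF assms]] show ?thesis by simp
qed

lemma topspace_weyl_dom:
  "topspace (subtopology (gelfand_topology B) (weyl_dom B n)) = weyl_dom B n"
  by (auto simp: topspace_gelfand weyl_dom_def)

lemma continuous_map_weyl_char:
  assumes n: "n \<in> normalizer B"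
  shows "continuous_map (subtopology (gelfand_topology B) (weyl_dom B n))
    (subtopology (gelfand_topology B) (weyl_dom B (adj n))) (weyl_char n)"
proof -
  let ?X = "subtopology (gelfand_topology B) (weyl_dom B n)"
  have "continuous_map ?X euclidean (\<lambda>x. weyl_char n x b)" if b: "b \<in> B" for b
  proof -
    \<comment> \<open>Continuity is treated as limits at points of the domain, where the denominator
      of \<open>weyl_char\<close> is nonzero.\<close>
    have ev: "((\<lambda>x. x c) \<longlongrightarrow> x c) (atin ?X x)" if "x \<in> weyl_dom B n" "c \<in> B" for x c
      using continuous_map_from_subtopology[OF continuous_map_eval[OF that(2)], of "weyl_dom B n"] that(1)
      by (simp add: continuous_map_atin topspace_weyl_dom del: topspace_subtopology)
    show ?thesis
      using b n
      by (auto simp: continuous_map_atin topspace_weyl_dom weyl_char_def weyl_dom_iff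
          simp del: topspace_subtopology intro!: tendsto_divide ev normalizer_conj normalizer_adj_mult)
  qed
  then have "continuous_map ?X (product_topology (\<lambda>_. euclidean) B) (weyl_char n)"
    by (auto simp: continuous_map_componentwise weyl_char_def)
  moreover have "weyl_char n ` weyl_dom B n \<subseteq> weyl_dom B (adj n)"
    using weyl_char_in_dom[OF n] by auto
  moreover have "weyl_dom B (adj n) \<subseteq> gelfand_spectrum B"
    by (auto simp: weyl_dom_def)
  ultimately show ?thesis
    unfolding gelfand_topology_def
    by (auto simp: continuous_map_in_subtopology topspace_weyl_dom[unfolded gelfand_topology_def])
qed

lemma homeomorphic_map_weyl_char:
  assumes n: "n \<in> normalizer B"
  shows "homeomorphic_map (subtopology (gelfand_topology B) (weyl_dom B n))
    (subtopology (gelfand_topology B) (weyl_dom B (adj n))) (weyl_char n)"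
  unfolding homeomorphic_map_maps homeomorphic_maps_def
  using continuous_map_weyl_char[OF n] continuous_map_weyl_char[OF normalizer_adj[OF n]]
    weyl_char_inverse[OF n] weyl_char_inverse[OF normalizer_adj[OF n]]
  by (intro exI[of _ "weyl_char (adj n)"]) (simp add: topspace_weyl_dom adj_adj)

text \<open>Existence and uniqueness of \<open>\<alpha>\<^sub>n\<close>: \<open>weyl_char n\<close>
  meets the specification, and dividing the identity by \<open>x (adj n * n)\<close> determines any
  competitor on \<open>B\<close>.\<close>

lemma weyl_map_eq:
  assumes n: "n \<in> normalizer B" and x: "x \<in> weyl_dom B n"
  shows "weyl_map B n x = weyl_char n x"
proof -
  have "weyl_map B n = restrict (weyl_char n) (weyl_dom B n)"
    unfolding weyl_map_def
  proof (rule the_equality)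
    have "homeomorphic_map (subtopology (gelfand_topology B) (weyl_dom B n))
        (subtopology (gelfand_topology B) (weyl_dom B (adj n))) (restrict (weyl_char n) (weyl_dom B n))"
      by (rule homeomorphic_map_eq[OF homeomorphic_map_weyl_char[OF n]])
        (simp add: topspace_weyl_dom)
    then show "restrict (weyl_char n) (weyl_dom B n) \<in> extensional (weyl_dom B n) \<and>
      homeomorphic_map (subtopology (gelfand_topology B) (weyl_dom B n))
       (subtopology (gelfand_topology B) (weyl_dom B (adj n))) (restrict (weyl_char n) (weyl_dom B n)) \<and>
      (\<forall>b\<in>B. \<forall>x\<in>gelfand_spectrum B. x (adj n * b * n) =
        (if x \<in> weyl_dom B n then restrict (weyl_char n) (weyl_dom B n) x b * x (adj n * n) else 0))"
      using n by (auto simp: weyl_char_def weyl_dom_iff char_normalizer_zero)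
  next
    fix \<alpha> assume \<alpha>: "\<alpha> \<in> extensional (weyl_dom B n) \<and>
      homeomorphic_map (subtopology (gelfand_topology B) (weyl_dom B n))
       (subtopology (gelfand_topology B) (weyl_dom B (adj n))) \<alpha> \<and>
      (\<forall>b\<in>B. \<forall>x\<in>gelfand_spectrum B. x (adj n * b * n) =
        (if x \<in> weyl_dom B n then \<alpha> x b * x (adj n * n) else 0))"
    \<comment> \<open>The competitor's values are characters, hence fixed off \<open>B\<close> as
      well; without this, agreement on \<open>B\<close> would not give equality.\<close>
    then have "\<alpha> ` weyl_dom B n = weyl_dom B (adj n)"
      using homeomorphic_imp_surjective_map topspace_weyl_dom by metis
    then have "\<alpha> x \<in> extensional B" if "x \<in> weyl_dom B n" for x
      using that char_extensional by (auto simp: weyl_dom_def)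
    moreover have "\<alpha> x b = weyl_char n x b" if x: "x \<in> weyl_dom B n" and b: "b \<in> B" for x b
    proof -
      have "x \<in> gelfand_spectrum B" "x (adj n * n) \<noteq> 0"
        using x by (simp_all add: weyl_dom_iff n)
      moreover from this have "x (adj n * b * n) = \<alpha> x b * x (adj n * n)"
        using \<alpha> x b by presburger
      ultimately show ?thesis using b by (simp add: weyl_char_def)
    qed
    ultimately have "\<alpha> x = weyl_char n x" if "x \<in> weyl_dom B n" for x
      using that by (intro extensionalityI[of _ B]) (auto simp: weyl_char_def)
    with \<alpha> show "\<alpha> = restrict (weyl_char n) (weyl_dom B n)"
      by (intro extensionalityI[of _ "weyl_dom B n"]) auto
  qed
  with x show ?thesis by simp
qed

section \<open>Agreement of two partial maps where the expectation does not vanish\<close>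

text \<open>A polarised Cauchy--Schwarz argument: positivity of \<open>E ((k + c b)\<^sup>* (k + c b))\<close> at \<open>z\<close>
  for all scalars \<open>c\<close> kills the terms linear in \<open>c\<close>.\<close>

lemma char_expectation_zero:
  assumes k: "k \<in> normalizer B" and z: "z \<in> gelfand_spectrum B" and zero: "z (adj k * k) = 0"
  shows "z (E k) = 0"
proof -
  \<comment> \<open>\<open>b\<close> stands in for a unit near \<open>z\<close>.\<close>
  obtain b where b: "b \<in> B" "z b \<noteq> 0" using z by (rule char_nonzeroE)
  define P where "P = z (E (adj k * b))"
  define Q where "Q = z (E (adj b * k))"
  define R where "R = (cmod (z b))\<^sup>2"
  have nonneg: "0 \<le> c * P + cnj c * Q + of_real ((cmod c)\<^sup>2 * R)" for c
  proof -
    obtain d where d: "d \<in> B" "E (adj (k + c *\<^sub>C b) * (k + c *\<^sub>C b)) = adj d * d"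
      using expectation_adj_mult by blast
    have "adj (k + c *\<^sub>C b) * (k + c *\<^sub>C b)
        = adj k * k + c *\<^sub>C (adj k * b) + cnj c *\<^sub>C (adj b * k) + (c * cnj c) *\<^sub>C (adj b * b)"
      by (simp add: adj_add adj_scaleC mult_scaleC_left mult_scaleC_right scaleC_scaleC
          scaleC_add_right distrib_left distrib_right add_ac mult.commute)
    then have "z (E (adj (k + c *\<^sub>C b) * (k + c *\<^sub>C b)))
        = z (adj k * k) + c * P + cnj c * Q + (c * cnj c) * z (adj b * b)"
      using b k
      by (simp add: expectation_add expectation_scale expectation_id normalizer_adj_mult mult_in
          adj_in char_add[OF z] char_scale[OF z] add_in scale_in expectation_in P_def Q_def)
    moreover have "(c * cnj c) * z (adj b * b) = of_real ((cmod c)\<^sup>2 * R)"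
      using b by (simp add: char_mult[OF z] char_adj[OF z] adj_in R_def mult.commute flip: complex_norm_square)
    ultimately show ?thesis
      using char_adj_mult_nonneg[OF z d(1)] d(2) zero by simp
  qed
  \<comment> \<open>\<open>t = 1\<close> shows that \<open>a\<close> is real; the minimiser
    \<open>- Re a / (2 * R)\<close> of the quadratic then forces \<open>Re a = 0\<close>.\<close>
  have lin: "a = 0" if "\<And>t :: real. 0 \<le> of_real t * a + of_real (t\<^sup>2 * R)" for a :: complex
  proof -
    have im: "Im a = 0" using that[of 1] by (simp add: less_eq_complex_def)
    have ge: "0 \<le> t * Re a + t\<^sup>2 * R" for t
      using that[of t] by (simp add: less_eq_complex_def)
    have R: "R > 0" using b by (simp add: R_def)
    have "0 \<le> - (Re a)\<^sup>2 / (4 * R)"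
      using ge[of "- Re a / (2 * R)"] R by (simp add: field_simps power2_eq_square)
    then have "Re a = 0" using R by (simp add: divide_simps split: if_splits)
    with im show ?thesis by (simp add: complex_eq_iff)
  qed
  \<comment> \<open>Real \<open>c\<close> isolates \<open>P + Q\<close>, and imaginary
    \<open>c\<close> isolates \<open>\<i> * (P - Q)\<close>.\<close>
  have "P + Q = 0"
  proof (rule lin)
    fix t :: real show "0 \<le> of_real t * (P + Q) + of_real (t\<^sup>2 * R)"
      using nonneg[of "of_real t"] by (simp add: distrib_left)
  qed
  moreover have "\<i> * (P - Q) = 0"
  proof (rule lin)
    fix t :: real show "0 \<le> of_real t * (\<i> * (P - Q)) + of_real (t\<^sup>2 * R)"
      using nonneg[of "\<i> * of_real t"] by (simp add: algebra_simps norm_mult)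
  qed
  ultimately have "Q = 0" by simp
  moreover have "Q = cnj (z b) * z (E k)"
    using b by (simp add: Q_def expectation_left adj_in char_mult[OF z] expectation_in char_adj[OF z])
  ultimately show ?thesis using b by simp
qed

lemma char_conj_eq:
  assumes k: "k \<in> normalizer B" and z: "z \<in> gelfand_spectrum B" and nz: "z (E k) \<noteq> 0"
    and b: "b \<in> B"
  shows "z (adj k * b * k) = z b * z (adj k * k)"
proof -
  have "k * (adj k * b * k) = (k * adj k) * b * k" by (simp add: mult.assoc)
  also have "(k * adj k) * b = b * (k * adj k)"
    by (simp add: commute normalizer_mult_adj k b)
  also have "b * (k * adj k) * k = b * k * (adj k * k)" by (simp add: mult.assoc)
  finally have "E (k * (adj k * b * k)) = E (b * k * (adj k * k))" by simp
  then have "E k * (adj k * b * k) = b * E k * (adj k * k)"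
    using k b by (simp add: expectation_right expectation_left normalizer_conj normalizer_adj_mult)
  then have "z (E k) * z (adj k * b * k) = z b * z (E k) * z (adj k * k)"
    using k b by (metis char_mult[OF z] expectation_in mult_in normalizer_adj_mult normalizer_conj)
  with nz show ?thesis by simp
qed

text \<open>For \<open>k = adj n * m\<close>, the map of \<open>k\<close> is that of
  \<open>adj n\<close> after that of \<open>m\<close>. As it fixes \<open>z\<close>, the map of
  \<open>adj n\<close> carries the image \<open>w\<close> of \<open>z\<close> under \<open>m\<close>
  back to \<open>z\<close>; inverting it gives the claim.\<close>

lemma weyl_char_eq:
  assumes n: "n \<in> normalizer B" and m: "m \<in> normalizer B"
    and z: "z \<in> gelfand_spectrum B" and nz: "z (E (adj n * m)) \<noteq> 0"
  shows "z \<in> weyl_dom B n" "z \<in> weyl_dom B m" "weyl_char n z = weyl_char m z"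
proof -
  define k where "k = adj n * m"
  have k: "k \<in> normalizer B" by (simp add: k_def n m normalizer_adj normalizer_mult)
  have kk: "adj k * k = adj m * (n * adj n) * m"
    and kbk: "adj k * b * k = adj m * (n * b * adj n) * m" for b
    by (simp_all add: k_def adj_mult adj_adj mult.assoc)
  \<comment> \<open>A zero of \<open>adj k * k\<close> at \<open>z\<close> would be a zero of
    \<open>E k\<close>. Being a conjugate by \<open>m\<close>, \<open>adj k * k\<close> can be
    nonzero at \<open>z\<close> only if \<open>z\<close> lies in
    \<open>weyl_dom B m\<close>.\<close>
  have nzk: "z (adj k * k) \<noteq> 0"
    using char_expectation_zero[OF k z] nz by (auto simp: k_def)
  have nzm: "z (adj m * m) \<noteq> 0"
    using nzk char_normalizer_zero[OF m z normalizer_mult_adj[OF n]] by (auto simp: kk)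
  then show zm: "z \<in> weyl_dom B m" by (simp add: weyl_dom_iff m z)
  define w where "w = weyl_char m z"
  have w: "w \<in> gelfand_spectrum B"
    using weyl_char_in_dom[OF m zm] by (simp add: w_def weyl_dom_def)
  have wn: "w (n * adj n) \<noteq> 0"
    using nzk nzm by (simp add: w_def weyl_char_def normalizer_mult_adj n kk)
  then have wd: "w \<in> weyl_dom B (adj n)"
    by (simp add: weyl_dom_iff normalizer_adj n adj_adj w)
  have "weyl_char (adj n) w = z"
  proof (rule extensionalityI[of _ B])
    fix b assume b: "b \<in> B"
    have "w (n * b * adj n) = z b * w (n * adj n)"
      using char_conj_eq[OF k z _ b] nz b n
      by (simp add: kk kbk w_def weyl_char_def normalizer_mult_adj normalizer_conj' flip: k_def)
    with b wn show "weyl_char (adj n) w b = z b"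
      by (simp add: weyl_char_def adj_adj)
  qed (simp_all add: weyl_char_def char_extensional[OF z])
  then show "z \<in> weyl_dom B n" "weyl_char n z = weyl_char m z"
    using weyl_char_in_dom[OF normalizer_adj[OF n] wd] weyl_char_inverse[OF normalizer_adj[OF n] wd]
    by (simp_all add: adj_adj w_def)
qed

subsection \<open>The Weyl groupoid\<close>

lemma equiv_weyl_rel: "equiv (weyl_triples B) (weyl_rel B)"
proof (rule equivI)
  show "weyl_rel B \<subseteq> weyl_triples B \<times> weyl_triples B"
    by (auto simp: weyl_rel_def)
  \<comment> \<open>The open domain itself serves as the neighbourhood.\<close>
  show "refl_on (weyl_triples B) (weyl_rel B)"
    using openin_weyl_dom by (fastforce simp: refl_on_def weyl_rel_def weyl_triples_def)
  show "sym (weyl_rel B)"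
    by (rule symI) (auto simp: weyl_rel_def; metis)
  show "trans (weyl_rel B)"
  proof (rule transI)
    fix p q r assume pq: "(p, q) \<in> weyl_rel B" and qr: "(q, r) \<in> weyl_rel B"
    obtain y n x y' m y'' l where eqs: "p = (y, n, x)" "q = (y', m, x)" "r = (y'', l, x)"
      and mem: "p \<in> weyl_triples B" "r \<in> weyl_triples B"
      using pq qr by (auto simp: weyl_rel_def)
    obtain U where U: "openin (gelfand_topology B) U" "x \<in> U"
      "U \<subseteq> weyl_dom B n \<inter> weyl_dom B m" "\<forall>z\<in>U. weyl_map B n z = weyl_map B m z"
      using pq by (auto simp: weyl_rel_def eqs)
    obtain V where V: "openin (gelfand_topology B) V" "x \<in> V"
      "V \<subseteq> weyl_dom B m \<inter> weyl_dom B l" "\<forall>z\<in>V. weyl_map B m z = weyl_map B l z"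
      using qr by (auto simp: weyl_rel_def eqs)
    have "openin (gelfand_topology B) (U \<inter> V)" "x \<in> U \<inter> V"
      "U \<inter> V \<subseteq> weyl_dom B n \<inter> weyl_dom B l" "\<forall>z\<in>U \<inter> V. weyl_map B n z = weyl_map B l z"
      using U V by auto
    then show "(p, r) \<in> weyl_rel B"
      using mem unfolding weyl_rel_def eqs by blast
  qed
qed

lemma weyl_rel_if_expectation:
  assumes n: "n \<in> normalizer B" and m: "m \<in> normalizer B"
    and x: "x \<in> gelfand_spectrum B" and nz: "x (E (adj n * m)) \<noteq> 0"
  shows "((weyl_map B n x, n, x), (weyl_map B m x, m, x)) \<in> weyl_rel B"
proof -
  \<comment> \<open>Open because \<open>E (adj n * m)\<close> lies in \<open>B\<close>, so
    evaluation at it is continuous on the spectrum.\<close>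
  let ?U = "{z \<in> gelfand_spectrum B. z (E (adj n * m)) \<noteq> 0}"
  have "openin (gelfand_topology B) ?U" "x \<in> ?U"
    using openin_nonvanishing expectation_in x nz by auto
  moreover have "z \<in> weyl_dom B n" "z \<in> weyl_dom B m" "weyl_map B n z = weyl_map B m z"
    if "z \<in> ?U" for z
    using that weyl_char_eq[OF n m, of z] by (auto simp: weyl_map_eq n m)
  ultimately show ?thesis
    using n m by (auto simp: weyl_rel_def weyl_triples_def intro!: exI[of _ ?U])
qed

lemma exists_expectation_nonzero:
  assumes n: "n \<in> normalizer B" and x: "x \<in> weyl_dom B n" and dense: "closure (cspan N) = UNIV"
  shows "\<exists>m\<in>N. x (E (adj n * m)) \<noteq> 0"
proof (rule ccontr)
  assume "\<not> ?thesis"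
  then have zero: "x (E (adj n * m)) = 0" if "m \<in> N" for m using that by blast
  have xs: "x \<in> gelfand_spectrum B" and nz: "x (adj n * n) \<noteq> 0"
    using x by (simp_all add: weyl_dom_iff n)
  \<comment> \<open>A closed subspace: \<open>E\<close> is linear and contractive, and
    \<open>x\<close> is linear and continuous on \<open>B\<close>. Containing \<open>N\<close>, it
    would contain \<open>n\<close> too.\<close>
  let ?K = "{a. x (E (adj n * a)) = 0}"
  have "csubspace ?K"
    by (rule complex_vector.subspaceI)
      (simp_all add: distrib_left mult_scaleC_right expectation_add expectation_scale
        expectation_id[OF zero_in] char_zero[OF xs] char_add[OF xs] char_scale[OF xs] expectation_in)
  then have "cspan N \<subseteq> ?K"
    using zero by (intro complex_vector.span_minimal) auto
  moreover have "closed ?K"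
  proof (rule closed_Collect_eq)
    show "continuous_on UNIV (\<lambda>a. x (E (adj n * a)))"
      unfolding continuous_on_def
      by (auto intro!: char_tendsto[OF xs] expectation_tendsto tendsto_intros simp: expectation_in)
  qed simp
  ultimately have "closure (cspan N) \<subseteq> ?K" by (rule closure_minimal)
  with dense have "x (E (adj n * n)) = 0" by auto
  with nz show False by (simp add: expectation_id normalizer_adj_mult n)
qed

end

theorem proposition4p1:
  fixes B N :: "'a::cstar_algebra set"
  assumes "separable_space (euclidean :: 'a topology)"
    and "cartan_subalgebra B"
    and "N \<subseteq> normalizer B"
    and "closure (cspan N) = UNIV"
  shows "\<forall>g \<in> weyl_groupoid B. \<exists>m\<in>N. \<exists>x\<in>weyl_dom B m.
           g = weyl_rel B `` {(weyl_map B m x, m, x)}"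
proof
  fix g assume "g \<in> weyl_groupoid B"
  then obtain n x where n: "n \<in> normalizer B" and x: "x \<in> weyl_dom B n"
    and g: "g = weyl_rel B `` {(weyl_map B n x, n, x)}"
    by (auto simp: weyl_groupoid_def weyl_triples_def elim!: quotientE)
  obtain E where "conditional_expectation B E"
    using assms(2) by (auto simp: cartan_subalgebra_def)
  then interpret expected_subalgebra B E
    using assms(2) by unfold_locales (auto simp: cartan_subalgebra_def maximal_abelian_def)
  \<comment> \<open>The base point \<open>x\<close> is kept; only the normalizer \<open>n\<close> is
    exchanged for an element of \<open>N\<close>.\<close>
  obtain m where m: "m \<in> N" and nz: "x (E (adj n * m)) \<noteq> 0"
    using exists_expectation_nonzero[OF n x assms(4)] by blast
  have xs: "x \<in> gelfand_spectrum B" using x by (simp add: weyl_dom_def)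
  have mn: "m \<in> normalizer B" using m assms(3) by blast
  have "g = weyl_rel B `` {(weyl_map B m x, m, x)}"
    unfolding g using equiv_class_eq[OF equiv_weyl_rel weyl_rel_if_expectation[OF n mn xs nz]] .
  moreover have "x \<in> weyl_dom B m" using weyl_char_eq(2)[OF n mn xs nz] .
  ultimately show "\<exists>m\<in>N. \<exists>x\<in>weyl_dom B m. g = weyl_rel B `` {(weyl_map B m x, m, x)}"
    using m by blast
qed

end
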